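(* Fix $L_x,L_{xy},L_y,D_x,D_y,\epsilon>0$ and consider the class $\mathcal P_{\mathrm{SP}}$ of saddle problems and the algorithm template DM-SP described in the context, where it is assumed that the local trajectories of DM-SP are those of a distributed method (every query point is a deterministic function of the information available to the querying agent, and every candidate solution is a deterministic function of the merged information). Choose $$\alpha_x=\frac{L_{xy}D_y}{D_x},\qquad \alpha_y=\frac{L_{xy}D_x}{D_y},\qquad \lambda_t\equiv\lambda=2 .$$ Then the communication complexity of DM-SP over $\mathcal P_{\mathrm{SP}}$ satisfies $$T^{\text{DM-SP}}_{\mathcal P_{\mathrm{SP}}}\le 2+4\,\frac{L_{xy}D_xD_y}{\epsilon}.$$
   Context: Spaces. $\mathcal E_x=\mathbb R^{n_x}$ carries the norm $\|x\|_x=\langle P_xx,x\rangle^{1/2}$, where $P_x:\mathcal E_x\to\mathcal E_x^*$ is self-adjoint positive definite; $\|\cdot\|_{x^*}$ is the dual norm. Similarly $\mathcal E_y=\mathbb R^{n_y}$ with $P_y$, $\|\cdot\|_y$, $\|\cdot\|_{y^*}$. For $\alpha_x,\alpha_y>0$ the joint space $\mathcal E=\mathcal E_x\times\mathcal E_y$ has norm $\|z\|_{\mathcal E}^2=\alpha_x\|x\|_x^2+\alpha_y\|y\|_y^2$ for $z=(x,y)$, with dual norm $\|(g_x,g_y)\|_{\mathcal E^*}^2=\alpha_x^{-1}\|g_x\|_{x^*}^2+\alpha_y^{-1}\|g_y\|_{y^*}^2$. Problem class $\mathcal P_{\mathrm{SP}}$. An instance is $(f,\psi_x,\psi_y,z^0)$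 with $\psi_x:\mathcal E_x\to\mathbb R\cup\{+\infty\}$, $\psi_y:\mathcal E_y\to\mathbb R\cup\{+\infty\}$, $Q=\operatorname{dom}\psi_x\times\operatorname{dom}\psi_y$, $f$ real-valued on an open set containing $Q$, $z^0=(x^0,y^0)\in Q$; the problem is $\min_{x\in\operatorname{dom}\psi_x}\max_{y\in\operatorname{dom}\psi_y}F(x,y)$, $F(x,y)=f(x,y)+\psi_x(x)-\psi_y(y)$. The class consists of all instances such that: (A1) $f(\cdot,y)$ is convex for each fixed $y\in\operatorname{dom}\psi_y$, $f(x,\cdot)$ is concave for each fixed $x\in\operatorname{dom}\psi_x$, and $\psi_x,\psi_y$ are proper, closed and convex; (A2) there is a saddle point $(x^*,y^* )\in Q$ of $F$ with $\|x^0-x^*\|_x\le D_x$ and $\|y^0-y^*\|_y\le D_y$; (A3) $f$ is continuously differentiable over $Q$ and for all $x,x'\in\operatorname{dom}\psi_x$, $y,y'\in\operatorname{dom}\psi_y$: $\|\nabla_xf(x',y')-\nabla_xf(x,y)\|_{x^*}\le L_x\|x'-x\|_x+L_{xy}\|y'-y\|_y$ and $\|\nabla_yf(x',y')-\nabla_yf(x,y)\|_{y^*}\le L_{xy}\|x'-x\|_x+L_y\|y'-y\|_y$. Agent $x$ knows $\psi_x$ and has the oracle $z\mapsto\nabla_xf(z)$; Agent $y$ knows $\psi_y$ and has the oracle $z\mapsto\nabla_yf(z)$ ($z\in Q$). Accuracy. $\mathcal B_x=\{x:\|x^0-x\|_x\le D_x\}$, $\mathcal B_y=\{y:\|y^0-y\|_y\le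 D_y\}$, $\mathcal B=\mathcal B_x\times\mathcal B_y$, and $\Delta(\bar x,\bar y)=\max_{(x,y)\in\mathcal B\cap Q}[F(\bar x,y)-F(x,\bar y)]$. A point $\bar z\in Q$ is an $\epsilon$-saddle point if $\Delta(\bar z)\le\epsilon$. Distributed method and communication complexity. A method proceeds in communication rounds $r=0,1,\dots$. In a round each agent makes several queries to its own oracle, each query point being a deterministic function of the sequence of oracle responses available to that agent (the initial point and the agent's own $\psi$ being known a priori); the available sequence is initially empty, each query appends its response, and at the end of each round both agents' sequences are replaced by the union (merged sequence) of the two. At the end of round $r$ a candidate solution, a deterministic function of the merged sequence, is produced. For an instance $P$, $T_P$ is the smallest $k\ge1$ such that the candidate solution after $k$ rounds is an $\epsilon$-saddle point, and $T_{\mathcal P_{\mathrm{SP}}}=\sup_{P\in\mathcal P_{\mathrm{SP}}}T_P$. Template DM-SP, with parameters $\alpha_x,\alpha_y>0$ and $(\lambda_t)_{t\ge1}$, $\lambda_t>0$. Put $v^0=z^0$. Iteration $t=0,1,\dots$, given $v^t=(v^t_x,v^t_y)$: (1) Agent $x$ finds $x^{t+1}$ and $\psi_x'(x^{t+1})\in\partial\psi_x(x^{t+1})$ with $\|\nabla_xf(x^{t+1},v^t_y)+\alpha_x\lambda_{t+1}P_x(x^{t+1}-v^t_x)+\psi_x'(x^{t+1})\|_{x^*}\le\frac{\alpha_x\lambda_{t+1}}2\|x^{t+1}-v^t_x\|_x$; Agent $y$ finds $y^{t+1}$ and $\psi_y'(y^{t+1})\in\partial\psi_y(y^{t+1})$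 with $\|-\nabla_yf(v^t_x,y^{t+1})+\alpha_y\lambda_{t+1}P_y(y^{t+1}-v^t_y)+\psi_y'(y^{t+1})\|_{y^*}\le\frac{\alpha_y\lambda_{t+1}}2\|y^{t+1}-v^t_y\|_y$. (2) The agents exchange $x^{t+1}$ and $y^{t+1}$ to form $z^{t+1}=(x^{t+1},y^{t+1})$ (first round of the iteration). (3) Each agent computes its coordinates at $z^{t+1}$, and they exchange (second round) to form $V_\psi(z^{t+1})=(\nabla_xf(z^{t+1})+\psi_x'(x^{t+1}),\,-\nabla_yf(z^{t+1})+\psi_y'(y^{t+1}))$. (4) $a_{t+1}=2\langle V_\psi(z^{t+1}),v^t-z^{t+1}\rangle/\|V_\psi(z^{t+1})\|_{\mathcal E^*}^2$, and the candidate solution is $\bar z^{t+1}=(\sum_{i=1}^{t+1}a_i)^{-1}\sum_{i=1}^{t+1}a_iz^i$. (5) $v^{t+1}=\arg\min_{v\in Q}\big[a_{t+1}\langle V_\psi(z^{t+1}),v\rangle+\frac12\|v-v^t\|_{\mathcal E}^2\big]$. Each iteration uses exactly two communication rounds: the candidate solution after $2(t+1)$ rounds is $\bar z^{t+1}$, and after the first round of an iteration the previous candidate is kept (initially $z^0$).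
   Formalization: When V_ψ(z^{t+1})=0, where a_{t+1} is 0/0, DM-SP is taken to stop with candidate z^{t+1}; the bound is stated for every subclass of P_SP on which a distributed method carries out DM-SP, since the argmin in step (5) may fail to exist when Q is not closed. *)

theory Defs
  imports "HOL-Analysis.Analysis"
begin

section \<open>Norms\<close>

text \<open>The dual space is identified with the space itself through the inner product, so that
  \<open>\<langle>s, x\<rangle> = s \<bullet> x\<close> and \<open>P\<close> is an endomorphism.\<close>

definition self_adjoint_pos_def :: "('a::euclidean_space \<Rightarrow> 'a) \<Rightarrow> bool" where
  "self_adjoint_pos_def P \<longleftrightarrow>
     linear P \<and> (\<forall>u w. P u \<bullet> w = u \<bullet> P w) \<and> (\<forall>u. u \<noteq> 0 \<longrightarrow> P u \<bullet> u > 0)"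

definition pnorm :: "('a::euclidean_space \<Rightarrow> 'a) \<Rightarrow> 'a \<Rightarrow> real" where
  "pnorm P u = sqrt (P u \<bullet> u)"

definition dual_pnorm :: "('a::euclidean_space \<Rightarrow> 'a) \<Rightarrow> 'a \<Rightarrow> real" where
  "dual_pnorm P g = (SUP u\<in>{u. pnorm P u \<le> 1}. g \<bullet> u)"

definition joint_norm_sq ::
  "('a::euclidean_space \<Rightarrow> 'a) \<Rightarrow> ('b::euclidean_space \<Rightarrow> 'b) \<Rightarrow> real \<Rightarrow> real \<Rightarrow> 'a \<times> 'b \<Rightarrow> real"
where
  "joint_norm_sq Px Py \<alpha>x \<alpha>y z =
     \<alpha>x * (pnorm Px (fst z))\<^sup>2 + \<alpha>y * (pnorm Py (snd z))\<^sup>2"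

definition joint_dual_norm_sq ::
  "('a::euclidean_space \<Rightarrow> 'a) \<Rightarrow> ('b::euclidean_space \<Rightarrow> 'b) \<Rightarrow> real \<Rightarrow> real \<Rightarrow> 'a \<times> 'b \<Rightarrow> real"
where
  "joint_dual_norm_sq Px Py \<alpha>x \<alpha>y g =
     (dual_pnorm Px (fst g))\<^sup>2 / \<alpha>x + (dual_pnorm Py (snd g))\<^sup>2 / \<alpha>y"


section \<open>Extended-valued convex functions and partial gradients\<close>

definition eff_dom :: "('a \<Rightarrow> ereal) \<Rightarrow> 'a set" where
  "eff_dom \<psi> = {u. \<psi> u < \<infinity>}"

definition ext_epigraph :: "('a \<Rightarrow> ereal) \<Rightarrow> ('a \<times> real) set" where
  "ext_epigraph \<psi> = {(u, r). \<psi> u \<le> ereal r}"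

definition proper_closed_convex :: "('a::euclidean_space \<Rightarrow> ereal) \<Rightarrow> bool" where
  "proper_closed_convex \<psi> \<longleftrightarrow>
     (\<forall>u. \<psi> u \<noteq> -\<infinity>) \<and> eff_dom \<psi> \<noteq> {} \<and>
     closed (ext_epigraph \<psi>) \<and> convex (ext_epigraph \<psi>)"

definition subdifferential :: "('a::euclidean_space \<Rightarrow> ereal) \<Rightarrow> 'a \<Rightarrow> 'a set" where
  "subdifferential \<psi> u =
     {g. u \<in> eff_dom \<psi> \<and> (\<forall>w. \<psi> w \<ge> \<psi> u + ereal (g \<bullet> (w - u)))}"

definition grad_x :: "('a::euclidean_space \<times> 'b::euclidean_space \<Rightarrow> real) \<Rightarrow> 'a \<times> 'b \<Rightarrow> 'a" where
  "grad_x f z = (THE g. GDERIV (\<lambda>u. f (u, snd z)) (fst z) :> g)"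

definition grad_y :: "('a::euclidean_space \<times> 'b::euclidean_space \<Rightarrow> real) \<Rightarrow> 'a \<times> 'b \<Rightarrow> 'b" where
  "grad_y f z = (THE g. GDERIV (\<lambda>w. f (fst z, w)) (snd z) :> g)"


section \<open>The problem class\<close>

text \<open>\<open>obj_f\<close> is total; only its values on the open set \<open>f_dom\<close> are meaningful, and nothing below
  depends on the others.\<close>

record ('a, 'b) saddle_instance =
  obj_f :: "'a \<times> 'b \<Rightarrow> real"
  f_dom :: "('a \<times> 'b) set"
  psi_x :: "'a \<Rightarrow> ereal"
  psi_y :: "'b \<Rightarrow> ereal"
  init_pt :: "'a \<times> 'b"

definition feasible :: "('a, 'b) saddle_instance \<Rightarrow> ('a \<times> 'b) set" where
  "feasible I = eff_dom (psi_x I) \<times> eff_dom (psi_y I)"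

text \<open>Used on \<open>feasible I\<close> only, where both \<open>\<psi>\<close>-values are finite.\<close>

definition saddle_obj :: "('a, 'b) saddle_instance \<Rightarrow> 'a \<Rightarrow> 'b \<Rightarrow> real" where
  "saddle_obj I x y =
     obj_f I (x, y) + real_of_ereal (psi_x I x) - real_of_ereal (psi_y I y)"

definition is_saddle_point :: "('a, 'b) saddle_instance \<Rightarrow> 'a \<times> 'b \<Rightarrow> bool" where
  "is_saddle_point I z \<longleftrightarrow> z \<in> feasible I \<and>
     (\<forall>x\<in>eff_dom (psi_x I). \<forall>y\<in>eff_dom (psi_y I).
        saddle_obj I (fst z) y \<le> saddle_obj I (fst z) (snd z) \<and>
        saddle_obj I (fst z) (snd z) \<le> saddle_obj I x (snd z))"

definition convex_concave ::
  "('a::euclidean_space, 'b::euclidean_space) saddle_instance \<Rightarrow> bool" where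
  "convex_concave I \<longleftrightarrow>
     (\<forall>y\<in>eff_dom (psi_y I). convex_on (eff_dom (psi_x I)) (\<lambda>x. obj_f I (x, y))) \<and>
     (\<forall>x\<in>eff_dom (psi_x I). concave_on (eff_dom (psi_y I)) (\<lambda>y. obj_f I (x, y))) \<and>
     proper_closed_convex (psi_x I) \<and> proper_closed_convex (psi_y I)"

definition has_near_saddle_point ::
  "('a::euclidean_space \<Rightarrow> 'a) \<Rightarrow> ('b::euclidean_space \<Rightarrow> 'b) \<Rightarrow> real \<Rightarrow> real \<Rightarrow>
   ('a, 'b) saddle_instance \<Rightarrow> bool" where
  "has_near_saddle_point Px Py Dx Dy I \<longleftrightarrow>
     (\<exists>z. is_saddle_point I z \<and>
          pnorm Px (fst (init_pt I) - fst z) \<le> Dx \<and> pnorm Py (snd (init_pt I) - snd z) \<le> Dy)"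

definition smooth_coupling ::
  "('a::euclidean_space \<Rightarrow> 'a) \<Rightarrow> ('b::euclidean_space \<Rightarrow> 'b) \<Rightarrow> real \<Rightarrow> real \<Rightarrow> real \<Rightarrow>
   ('a, 'b) saddle_instance \<Rightarrow> bool" where
  "smooth_coupling Px Py Lx Lxy Ly I \<longleftrightarrow>
     (\<forall>z\<in>feasible I. obj_f I differentiable (at z)) \<and>
     continuous_on (feasible I) (grad_x (obj_f I)) \<and>
     continuous_on (feasible I) (grad_y (obj_f I)) \<and>
     (\<forall>x\<in>eff_dom (psi_x I). \<forall>x'\<in>eff_dom (psi_x I).
      \<forall>y\<in>eff_dom (psi_y I). \<forall>y'\<in>eff_dom (psi_y I).
        dual_pnorm Px (grad_x (obj_f I) (x', y') - grad_x (obj_f I) (x, y))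
          \<le> Lx * pnorm Px (x' - x) + Lxy * pnorm Py (y' - y) \<and>
        dual_pnorm Py (grad_y (obj_f I) (x', y') - grad_y (obj_f I) (x, y))
          \<le> Lxy * pnorm Px (x' - x) + Ly * pnorm Py (y' - y))"

definition saddle_class ::
  "('a::euclidean_space \<Rightarrow> 'a) \<Rightarrow> ('b::euclidean_space \<Rightarrow> 'b) \<Rightarrow> real \<Rightarrow> real \<Rightarrow> real \<Rightarrow>
   real \<Rightarrow> real \<Rightarrow> ('a, 'b) saddle_instance set" where
  "saddle_class Px Py Lx Lxy Ly Dx Dy =
     {I. open (f_dom I) \<and> feasible I \<subseteq> f_dom I \<and> init_pt I \<in> feasible I \<and>
         convex_concave I \<and> has_near_saddle_point Px Py Dx Dy I \<and>
         smooth_coupling Px Py Lx Lxy Ly I}"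


section \<open>Accuracy\<close>

definition trust_region ::
  "('a::euclidean_space \<Rightarrow> 'a) \<Rightarrow> ('b::euclidean_space \<Rightarrow> 'b) \<Rightarrow> real \<Rightarrow> real \<Rightarrow>
   ('a, 'b) saddle_instance \<Rightarrow> ('a \<times> 'b) set" where
  "trust_region Px Py Dx Dy I =
     {x. pnorm Px (fst (init_pt I) - x) \<le> Dx} \<times> {y. pnorm Py (snd (init_pt I) - y) \<le> Dy}"

text \<open>The supremum is taken in the extended reals; it is the maximum whenever that exists.\<close>

definition saddle_gap ::
  "('a::euclidean_space \<Rightarrow> 'a) \<Rightarrow> ('b::euclidean_space \<Rightarrow> 'b) \<Rightarrow> real \<Rightarrow> real \<Rightarrow>
   ('a, 'b) saddle_instance \<Rightarrow> 'a \<times> 'b \<Rightarrow> ereal" where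
  "saddle_gap Px Py Dx Dy I w =
     (SUP z\<in>trust_region Px Py Dx Dy I \<inter> feasible I.
        ereal (saddle_obj I (fst w) (snd z) - saddle_obj I (fst z) (snd w)))"

definition eps_saddle_point ::
  "('a::euclidean_space \<Rightarrow> 'a) \<Rightarrow> ('b::euclidean_space \<Rightarrow> 'b) \<Rightarrow> real \<Rightarrow> real \<Rightarrow> real \<Rightarrow>
   ('a, 'b) saddle_instance \<Rightarrow> 'a \<times> 'b \<Rightarrow> bool" where
  "eps_saddle_point Px Py Dx Dy \<epsilon> I w \<longleftrightarrow>
     w \<in> feasible I \<and> saddle_gap Px Py Dx Dy I w \<le> ereal \<epsilon>"


section \<open>Distributed methods\<close>

text \<open>A response records the point that was queried together with the partial gradient there, so
  that merging the sequences also exchanges the query points.\<close>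

datatype ('a, 'b) response = RespX "'a \<times> 'b" 'a | RespY "'a \<times> 'b" 'b

text \<open>\<open>query_x M r j z0 \<psi>x S\<close> is the \<open>j\<close>-th query point of Agent x in round \<open>r\<close> when the available
  sequence is \<open>S\<close>, with \<open>None\<close> meaning that the agent ends its local phase.
  \<open>candidate M k z0 S\<close> is the candidate solution after \<open>k\<close> rounds, \<open>S\<close> being the merged sequence.\<close>

record ('a, 'b) dist_method =
  query_x :: "nat \<Rightarrow> nat \<Rightarrow> 'a \<times> 'b \<Rightarrow> ('a \<Rightarrow> ereal) \<Rightarrow> ('a, 'b) response list \<Rightarrow> ('a \<times> 'b) option"
  query_y :: "nat \<Rightarrow> nat \<Rightarrow> 'a \<times> 'b \<Rightarrow> ('b \<Rightarrow> ereal) \<Rightarrow> ('a, 'b) response list \<Rightarrow> ('a \<times> 'b) option"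
  candidate :: "nat \<Rightarrow> 'a \<times> 'b \<Rightarrow> ('a, 'b) response list \<Rightarrow> 'a \<times> 'b"

primrec local_responses ::
  "(nat \<Rightarrow> 'r list \<Rightarrow> 'q option) \<Rightarrow> ('q \<Rightarrow> 'r) \<Rightarrow> 'r list \<Rightarrow> nat \<Rightarrow> 'r list" where
  "local_responses query answer S 0 = []"
| "local_responses query answer S (Suc j) =
     (case query j (S @ local_responses query answer S j) of
        None \<Rightarrow> local_responses query answer S j
      | Some z \<Rightarrow> local_responses query answer S j @ [answer z])"

definition local_phase ::
  "(nat \<Rightarrow> 'r list \<Rightarrow> 'q option) \<Rightarrow> ('q \<Rightarrow> 'r) \<Rightarrow> 'r list \<Rightarrow> 'r list" where
  "local_phase query answer S =
     local_responses query answer S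
       (LEAST n. query n (S @ local_responses query answer S n) = None)"

text \<open>The local phase ends after finitely many queries, all at points of \<open>Q\<close>.\<close>

definition local_phase_ok ::
  "'q set \<Rightarrow> (nat \<Rightarrow> 'r list \<Rightarrow> 'q option) \<Rightarrow> ('q \<Rightarrow> 'r) \<Rightarrow> 'r list \<Rightarrow> bool" where
  "local_phase_ok Q query answer S \<longleftrightarrow>
     (\<exists>n. query n (S @ local_responses query answer S n) = None \<and>
          (\<forall>j<n. \<exists>z\<in>Q. query j (S @ local_responses query answer S j) = Some z))"

definition oracle_x ::
  "('a::euclidean_space, 'b::euclidean_space) saddle_instance \<Rightarrow> 'a \<times> 'b \<Rightarrow> ('a, 'b) response" where
  "oracle_x I z = RespX z (grad_x (obj_f I) z)"

definition oracle_y ::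
  "('a::euclidean_space, 'b::euclidean_space) saddle_instance \<Rightarrow> 'a \<times> 'b \<Rightarrow> ('a, 'b) response" where
  "oracle_y I z = RespY z (grad_y (obj_f I) z)"

abbreviation rule_x ::
  "('a, 'b) dist_method \<Rightarrow> ('a, 'b) saddle_instance \<Rightarrow> nat \<Rightarrow>
   nat \<Rightarrow> ('a, 'b) response list \<Rightarrow> ('a \<times> 'b) option" where
  "rule_x M I r \<equiv> (\<lambda>j S. query_x M r j (init_pt I) (psi_x I) S)"

abbreviation rule_y ::
  "('a, 'b) dist_method \<Rightarrow> ('a, 'b) saddle_instance \<Rightarrow> nat \<Rightarrow>
   nat \<Rightarrow> ('a, 'b) response list \<Rightarrow> ('a \<times> 'b) option" where
  "rule_y M I r \<equiv> (\<lambda>j S. query_y M r j (init_pt I) (psi_y I) S)"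

text \<open>\<open>merged M I k\<close> is the common sequence of both agents after \<open>k\<close> rounds, i.e. at the start of
  round \<open>k\<close>.\<close>

primrec merged ::
  "('a::euclidean_space, 'b::euclidean_space) dist_method \<Rightarrow> ('a, 'b) saddle_instance \<Rightarrow> nat \<Rightarrow>
   ('a, 'b) response list" where
  "merged M I 0 = []"
| "merged M I (Suc r) =
     merged M I r @ local_phase (rule_x M I r) (oracle_x I) (merged M I r)
                  @ local_phase (rule_y M I r) (oracle_y I) (merged M I r)"

definition legal_run ::
  "('a::euclidean_space, 'b::euclidean_space) dist_method \<Rightarrow> ('a, 'b) saddle_instance \<Rightarrow> bool" where
  "legal_run M I \<longleftrightarrow>
     (\<forall>r. local_phase_ok (feasible I) (rule_x M I r) (oracle_x I) (merged M I r) \<and>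
          local_phase_ok (feasible I) (rule_y M I r) (oracle_y I) (merged M I r))"

definition candidate_after ::
  "('a::euclidean_space, 'b::euclidean_space) dist_method \<Rightarrow> ('a, 'b) saddle_instance \<Rightarrow> nat \<Rightarrow> 'a \<times> 'b"
where
  "candidate_after M I k = candidate M k (init_pt I) (merged M I k)"

text \<open>The infimum of the empty set is \<open>\<infinity>\<close>.\<close>

definition comm_time ::
  "('a::euclidean_space \<Rightarrow> 'a) \<Rightarrow> ('b::euclidean_space \<Rightarrow> 'b) \<Rightarrow> real \<Rightarrow> real \<Rightarrow> real \<Rightarrow>
   ('a, 'b) dist_method \<Rightarrow> ('a, 'b) saddle_instance \<Rightarrow> enat" where
  "comm_time Px Py Dx Dy \<epsilon> M I =
     (INF k\<in>{k. k \<ge> 1 \<and> eps_saddle_point Px Py Dx Dy \<epsilon> I (candidate_after M I k)}. enat k)"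

text \<open>The class of instances is a parameter. For DM-SP it has to be allowed to be smaller than
  \<open>saddle_class\<close>: a closed function need not have a closed domain, and the minimum over \<open>Q\<close> in the
  last step of an iteration need not be attained then, so that no method carries out DM-SP on every
  instance of \<open>saddle_class\<close>.\<close>

definition comm_complexity ::
  "('a::euclidean_space \<Rightarrow> 'a) \<Rightarrow> ('b::euclidean_space \<Rightarrow> 'b) \<Rightarrow> real \<Rightarrow> real \<Rightarrow> real \<Rightarrow>
   ('a, 'b) dist_method \<Rightarrow> ('a, 'b) saddle_instance set \<Rightarrow> enat" where
  "comm_complexity Px Py Dx Dy \<epsilon> M \<C> = (SUP I\<in>\<C>. comm_time Px Py Dx Dy \<epsilon> M I)"


section \<open>The template DM-SP\<close>

text \<open>\<open>g\<close> is the chosen pair of subgradients of \<open>\<psi>\<^sub>x\<close> and \<open>\<psi>\<^sub>y\<close> at \<open>z\<close>.\<close>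

definition V_psi ::
  "('a::euclidean_space, 'b::euclidean_space) saddle_instance \<Rightarrow> 'a \<times> 'b \<Rightarrow> 'a \<times> 'b \<Rightarrow> 'a \<times> 'b" where
  "V_psi I z g = (grad_x (obj_f I) z + fst g, - grad_y (obj_f I) z + snd g)"

definition local_solution ::
  "('a::euclidean_space \<Rightarrow> 'a) \<Rightarrow> ('b::euclidean_space \<Rightarrow> 'b) \<Rightarrow> real \<Rightarrow> real \<Rightarrow> real \<Rightarrow>
   ('a, 'b) saddle_instance \<Rightarrow> 'a \<times> 'b \<Rightarrow> 'a \<times> 'b \<Rightarrow> 'a \<times> 'b \<Rightarrow> bool" where
  "local_solution Px Py \<alpha>x \<alpha>y l I v z g \<longleftrightarrow>
     fst g \<in> subdifferential (psi_x I) (fst z) \<and>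
     dual_pnorm Px (grad_x (obj_f I) (fst z, snd v) + (\<alpha>x * l) *\<^sub>R Px (fst z - fst v) + fst g)
       \<le> \<alpha>x * l / 2 * pnorm Px (fst z - fst v) \<and>
     snd g \<in> subdifferential (psi_y I) (snd z) \<and>
     dual_pnorm Py (- grad_y (obj_f I) (fst v, snd z) + (\<alpha>y * l) *\<^sub>R Py (snd z - snd v) + snd g)
       \<le> \<alpha>y * l / 2 * pnorm Py (snd z - snd v)"

text \<open>Iteration \<open>t\<close> is reached only if no earlier iteration produced a zero of \<open>V_psi\<close>.\<close>

definition reached ::
  "('a::euclidean_space, 'b::euclidean_space) saddle_instance \<Rightarrow> (nat \<Rightarrow> 'a \<times> 'b) \<Rightarrow>
   (nat \<Rightarrow> 'a \<times> 'b) \<Rightarrow> nat \<Rightarrow> bool" where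
  "reached I z g t \<longleftrightarrow> (\<forall>s<t. V_psi I (z (Suc s)) (g (Suc s)) \<noteq> 0)"

text \<open>If \<open>V_psi\<close> vanishes at \<open>z (Suc t)\<close>, the quotient defining \<open>a (Suc t)\<close> is meaningless, but
  \<open>z (Suc t)\<close> is an exact saddle point; by convention the method then stops with this point as its
  candidate.\<close>

definition dm_sp_trajectory ::
  "('a::euclidean_space \<Rightarrow> 'a) \<Rightarrow> ('b::euclidean_space \<Rightarrow> 'b) \<Rightarrow> real \<Rightarrow> real \<Rightarrow> (nat \<Rightarrow> real) \<Rightarrow>
   ('a, 'b) saddle_instance \<Rightarrow> (nat \<Rightarrow> 'a \<times> 'b) \<Rightarrow> (nat \<Rightarrow> 'a \<times> 'b) \<Rightarrow> (nat \<Rightarrow> 'a \<times> 'b) \<Rightarrow>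
   (nat \<Rightarrow> real) \<Rightarrow> (nat \<Rightarrow> 'a \<times> 'b) \<Rightarrow> bool" where
  "dm_sp_trajectory Px Py \<alpha>x \<alpha>y lam I v z g a zbar \<longleftrightarrow>
     v 0 = init_pt I \<and> zbar 0 = init_pt I \<and>
     (\<forall>t. reached I z g t \<longrightarrow>
        local_solution Px Py \<alpha>x \<alpha>y (lam (Suc t)) I (v t) (z (Suc t)) (g (Suc t)) \<and>
        (let V = V_psi I (z (Suc t)) (g (Suc t)) in
           if V = 0 then (\<forall>k\<ge>Suc t. zbar k = z (Suc t))
           else
             a (Suc t) = 2 * (V \<bullet> (v t - z (Suc t))) / joint_dual_norm_sq Px Py \<alpha>x \<alpha>y V \<and>
             zbar (Suc t) = (1 / (\<Sum>i=1..Suc t. a i)) *\<^sub>R (\<Sum>i=1..Suc t. a i *\<^sub>R z i) \<and>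
             is_arg_min (\<lambda>w. a (Suc t) * (V \<bullet> w) + joint_norm_sq Px Py \<alpha>x \<alpha>y (w - v t) / 2)
               (\<lambda>w. w \<in> feasible I) (v (Suc t))))"

text \<open>The method \<open>M\<close> carries out DM-SP on the instance \<open>I\<close>: iteration \<open>t\<close> occupies rounds \<open>2t\<close>
  and \<open>2t+1\<close>, the gradients entering the two local problems have been queried by the end of the
  former, the gradients at \<open>z (Suc t)\<close> by the end of the latter, and the candidates are those of
  the template.\<close>

definition runs_dm_sp ::
  "('a::euclidean_space \<Rightarrow> 'a) \<Rightarrow> ('b::euclidean_space \<Rightarrow> 'b) \<Rightarrow> real \<Rightarrow> real \<Rightarrow> (nat \<Rightarrow> real) \<Rightarrow>
   ('a, 'b) dist_method \<Rightarrow> ('a, 'b) saddle_instance \<Rightarrow> bool" where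
  "runs_dm_sp Px Py \<alpha>x \<alpha>y lam M I \<longleftrightarrow> legal_run M I \<and>
     (\<exists>v z g a zbar. dm_sp_trajectory Px Py \<alpha>x \<alpha>y lam I v z g a zbar \<and>
        (\<forall>t. reached I z g t \<longrightarrow>
           oracle_x I (fst (z (Suc t)), snd (v t)) \<in> set (merged M I (2 * t + 1)) \<and>
           oracle_y I (fst (v t), snd (z (Suc t))) \<in> set (merged M I (2 * t + 1)) \<and>
           oracle_x I (z (Suc t)) \<in> set (merged M I (2 * t + 2)) \<and>
           oracle_y I (z (Suc t)) \<in> set (merged M I (2 * t + 2))) \<and>
        (\<forall>t. candidate_after M I (2 * t + 1) = zbar t \<and>
             candidate_after M I (2 * t + 2) = zbar (Suc t)))"

end

theory Submission
  imports Defs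
begin

text \<open>On the product space, \<open>(x, y) \<mapsto> (\<alpha>\<^sub>x P\<^sub>x x, \<alpha>\<^sub>y P\<^sub>y y)\<close> is again self-adjoint and positive
  definite, and the joint norms are the ones it induces. With \<open>\<alpha>\<^sub>x \<alpha>\<^sub>y = L\<^sub>x\<^sub>y\<^sup>2\<close> the two local
  conditions say that \<open>V\<close> differs from \<open>2 B (v - z)\<close> by at most \<open>2 \<parallel>v - z\<parallel>\<close> in the dual norm: half
  of this is the inexactness of the local solutions and half the error of using the old point of the
  other agent. Expanding the square gives \<open>a \<ge> 1/2\<close>. The step length \<open>a\<close> is the one for which the
  prox step yields \<open>a \<langle>V, z - u\<rangle> \<le> (\<parallel>v - u\<parallel>\<^sup>2 - \<parallel>v\<^sup>+ - u\<parallel>\<^sup>2) / 2\<close>; telescoping and Jensen's inequality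
  bound the gap after \<open>T\<close> iterations by \<open>2 L\<^sub>x\<^sub>y D\<^sub>x D\<^sub>y / T\<close>.\<close>


section \<open>Norms induced by positive definite operators\<close>

lemma self_adjoint_pos_defD:
  assumes "self_adjoint_pos_def P"
  shows "linear P" and "P u \<bullet> w = u \<bullet> P w" and "P u \<bullet> u \<ge> 0"
proof -
  show lin: "linear P" and "P u \<bullet> w = u \<bullet> P w"
    using assms by (auto simp: self_adjoint_pos_def_def)
  show "P u \<bullet> u \<ge> 0"
    using assms linear_0[OF lin] by (cases "u = 0") (auto simp: self_adjoint_pos_def_def less_imp_le)
qed

lemma pnorm_nonneg:
  assumes "self_adjoint_pos_def P" shows "pnorm P u \<ge> 0"
  using self_adjoint_pos_defD(3)[OF assms] by (simp add: pnorm_def)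

lemma pnorm_power2:
  assumes "self_adjoint_pos_def P" shows "(pnorm P u)\<^sup>2 = P u \<bullet> u"
  using self_adjoint_pos_defD(3)[OF assms] by (simp add: pnorm_def)

lemma pnorm_eq_0_iff:
  assumes "self_adjoint_pos_def P" shows "pnorm P u = 0 \<longleftrightarrow> u = 0"
proof (cases "u = 0")
  case True
  then show ?thesis by (simp add: pnorm_def)
next
  case False
  then have "P u \<bullet> u > 0" using assms unfolding self_adjoint_pos_def_def by blast
  then show ?thesis using False by (simp add: pnorm_def)
qed

lemma pnorm_scaleR:
  assumes "self_adjoint_pos_def P" shows "pnorm P (c *\<^sub>R u) = \<bar>c\<bar> * pnorm P u"
proof -
  have "P (c *\<^sub>R u) \<bullet> (c *\<^sub>R u) = c\<^sup>2 * (P u \<bullet> u)"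
    by (simp add: linear_scale[OF self_adjoint_pos_defD(1)[OF assms]] power2_eq_square)
  then show ?thesis by (simp add: pnorm_def real_sqrt_mult)
qed

lemma pnorm_power2_add:
  assumes "self_adjoint_pos_def P"
  shows "(pnorm P (u + w))\<^sup>2 = (pnorm P u)\<^sup>2 + 2 * (P u \<bullet> w) + (pnorm P w)\<^sup>2"
  using self_adjoint_pos_defD(2)[OF assms, of w u]
  by (simp add: pnorm_power2[OF assms] linear_add[OF self_adjoint_pos_defD(1)[OF assms]]
      inner_add_left inner_add_right inner_commute)

text \<open>Expand the square of the norm of \<open>q u - p w\<close>, where p and q are the norms
  of u and w: every term carries a factor \<open>p * q\<close>, which can be divided out.\<close>

lemma pnorm_Cauchy_Schwarz:
  assumes "self_adjoint_pos_def P"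
  shows "P u \<bullet> w \<le> pnorm P u * pnorm P w"
proof (cases "u = 0 \<or> w = 0")
  case True
  then show ?thesis
    using linear_0[OF self_adjoint_pos_defD(1)[OF assms]] by (auto simp: pnorm_def)
next
  case False
  define p q where "p = pnorm P u" and "q = pnorm P w"
  have pos: "p > 0" "q > 0"
    using False pnorm_nonneg[OF assms] pnorm_eq_0_iff[OF assms]
    by (auto simp: p_def q_def order_less_le)
  have "0 \<le> (pnorm P (q *\<^sub>R u + (- p) *\<^sub>R w))\<^sup>2" by simp
  also have "\<dots> = (q * p)\<^sup>2 - 2 * (q * p) * (P u \<bullet> w) + (p * q)\<^sup>2"
    using pos by (simp only: pnorm_power2_add[OF assms] pnorm_scaleR[OF assms]
        linear_scale[OF self_adjoint_pos_defD(1)[OF assms]])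
      (simp add: p_def q_def)
  finally have "(p * q) * (P u \<bullet> w) \<le> (p * q) * (p * q)"
    by (simp add: power2_eq_square algebra_simps)
  then show ?thesis using pos by (simp add: p_def q_def)
qed

lemma pnorm_triangle:
  assumes "self_adjoint_pos_def P"
  shows "pnorm P (u + w) \<le> pnorm P u + pnorm P w"
proof (rule power2_le_imp_le)
  show "(pnorm P (u + w))\<^sup>2 \<le> (pnorm P u + pnorm P w)\<^sup>2"
    using pnorm_Cauchy_Schwarz[OF assms, of u w]
    by (simp add: pnorm_power2_add[OF assms] power2_sum)
  show "0 \<le> pnorm P u + pnorm P w" by (simp add: pnorm_nonneg[OF assms])
qed

section \<open>The dual norm, transported to the primal norm\<close>

lemma self_adjoint_pos_def_surj:
  assumes "self_adjoint_pos_def P"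
  obtains h where "g = P h"
proof -
  \<comment> \<open>Positive definiteness gives a trivial kernel, and finite dimension turns
    injectivity into surjectivity. Every dual vector is thus some \<open>P h\<close>, which reduces
    facts about dual norms to facts about primal norms.\<close>
  have "inj P"
    using assms unfolding linear_injective_0[OF self_adjoint_pos_defD(1)[OF assms]]
    by (fastforce simp: self_adjoint_pos_def_def)
  then have "surj P"
    using linear_injective_imp_surjective[OF self_adjoint_pos_defD(1)[OF assms]] by simp
  then show ?thesis using that by (metis surjD)
qed

text \<open>The supremum is attained at h divided by its norm, and Cauchy-Schwarz bounds all other
  candidates.\<close>

lemma dual_pnorm_image:
  assumes "self_adjoint_pos_def P"
  shows "dual_pnorm P (P h) = pnorm P h"
  unfolding dual_pnorm_def
proof (rule cSup_eq_maximum)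
  \<comment> \<open>For h = 0 the convention \<open>1 / 0 = 0\<close> makes this witness 0, and the
    value attained is still the norm of h.\<close>
  let ?u = "(1 / pnorm P h) *\<^sub>R h"
  have "pnorm P ?u \<le> 1"
    using pnorm_nonneg[OF assms, of h] by (simp add: pnorm_scaleR[OF assms])
  moreover have "P h \<bullet> ?u = pnorm P h"
    by (simp add: pnorm_power2[OF assms, symmetric] power2_eq_square)
  ultimately show "pnorm P h \<in> (\<lambda>u. P h \<bullet> u) ` {u. pnorm P u \<le> 1}"
    by (intro image_eqI[of _ _ ?u]) auto
next
  fix r assume "r \<in> (\<lambda>u. P h \<bullet> u) ` {u. pnorm P u \<le> 1}"
  then obtain u where "pnorm P u \<le> 1" "r = P h \<bullet> u" by auto
  then show "r \<le> pnorm P h"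
    using pnorm_Cauchy_Schwarz[OF assms, of h u] pnorm_nonneg[OF assms, of h]
    by (metis mult_left_mono mult.right_neutral order_trans)
qed

lemma dual_pnorm_nonneg:
  assumes "self_adjoint_pos_def P" shows "dual_pnorm P g \<ge> 0"
  by (metis assms dual_pnorm_image pnorm_nonneg self_adjoint_pos_def_surj)

lemma dual_pnorm_eq_0_iff:
  assumes "self_adjoint_pos_def P" shows "dual_pnorm P g = 0 \<longleftrightarrow> g = 0"
proof -
  obtain h where h: "g = P h" by (rule self_adjoint_pos_def_surj[OF assms])
  have "pnorm P h = 0 \<longleftrightarrow> P h = 0"
    using pnorm_eq_0_iff[OF assms, of h] linear_0[OF self_adjoint_pos_defD(1)[OF assms]]
    by (auto simp: pnorm_def)
  then show ?thesis by (simp add: h dual_pnorm_image[OF assms])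
qed

lemma dual_pnorm_triangle:
  assumes "self_adjoint_pos_def P"
  shows "dual_pnorm P (g + g') \<le> dual_pnorm P g + dual_pnorm P g'"
proof -
  obtain h h' where "g = P h" "g' = P h'"
    by (metis self_adjoint_pos_def_surj[OF assms])
  moreover have "P h + P h' = P (h + h')"
    by (simp add: linear_add[OF self_adjoint_pos_defD(1)[OF assms]])
  ultimately show ?thesis
    by (simp add: dual_pnorm_image[OF assms] pnorm_triangle[OF assms])
qed

lemma dual_pnorm_minus:
  assumes "self_adjoint_pos_def P"
  shows "dual_pnorm P (- g) = dual_pnorm P g"
proof -
  obtain h where "g = P h" by (rule self_adjoint_pos_def_surj[OF assms])
  moreover have "- P h = P (- h)"
    by (simp add: linear_neg[OF self_adjoint_pos_defD(1)[OF assms]])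
  ultimately show ?thesis
    using pnorm_scaleR[OF assms, of "- 1" h] by (simp add: dual_pnorm_image[OF assms])
qed

lemma inner_le_dual_pnorm:
  assumes "self_adjoint_pos_def P"
  shows "g \<bullet> u \<le> dual_pnorm P g * pnorm P u"
  by (metis assms dual_pnorm_image pnorm_Cauchy_Schwarz self_adjoint_pos_def_surj)

text \<open>Serves to treat the product as a space with a single operator: every lemma about one
  \<open>P\<close> then applies to the joint space.\<close>

definition joint_op ::
  "('a::euclidean_space \<Rightarrow> 'a) \<Rightarrow> ('b::euclidean_space \<Rightarrow> 'b) \<Rightarrow> real \<Rightarrow> real \<Rightarrow> 'a \<times> 'b \<Rightarrow> 'a \<times> 'b"
where
  "joint_op Px Py \<alpha>x \<alpha>y z = (\<alpha>x *\<^sub>R Px (fst z), \<alpha>y *\<^sub>R Py (snd z))"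

lemma self_adjoint_pos_def_joint_op:
  assumes "self_adjoint_pos_def Px" "self_adjoint_pos_def Py" "\<alpha>x > 0" "\<alpha>y > 0"
  shows "self_adjoint_pos_def (joint_op Px Py \<alpha>x \<alpha>y)"
  unfolding self_adjoint_pos_def_def
proof (intro conjI allI impI)
  note linx = self_adjoint_pos_defD(1)[OF assms(1)]
  note liny = self_adjoint_pos_defD(1)[OF assms(2)]
  show "linear (joint_op Px Py \<alpha>x \<alpha>y)"
    by (rule linearI)
      (simp_all add: joint_op_def linear_add[OF linx] linear_add[OF liny] linear_scale[OF linx]
        linear_scale[OF liny] scaleR_right_distrib)
  show "joint_op Px Py \<alpha>x \<alpha>y u \<bullet> w = u \<bullet> joint_op Px Py \<alpha>x \<alpha>y w" for u w
    using self_adjoint_pos_defD(2)[OF assms(1)] self_adjoint_pos_defD(2)[OF assms(2)]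
    by (simp add: joint_op_def inner_prod_def)
  show "joint_op Px Py \<alpha>x \<alpha>y u \<bullet> u > 0" if "u \<noteq> 0" for u
  proof -
    have "fst u \<noteq> 0 \<or> snd u \<noteq> 0" using that by (simp add: prod_eq_iff)
    moreover have "Px (fst u) \<bullet> fst u > 0" if "fst u \<noteq> 0"
      using that assms(1) unfolding self_adjoint_pos_def_def by blast
    moreover have "Py (snd u) \<bullet> snd u > 0" if "snd u \<noteq> 0"
      using that assms(2) unfolding self_adjoint_pos_def_def by blast
    ultimately show ?thesis
      using self_adjoint_pos_defD(3)[OF assms(1), of "fst u"]
        self_adjoint_pos_defD(3)[OF assms(2), of "snd u"] assms(3,4)
      by (auto simp: joint_op_def inner_prod_def intro: add_pos_nonneg add_nonneg_pos)
  qed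
qed

lemma joint_norm_sq_eq:
  assumes "self_adjoint_pos_def Px" "self_adjoint_pos_def Py" "\<alpha>x > 0" "\<alpha>y > 0"
  shows "joint_norm_sq Px Py \<alpha>x \<alpha>y z = (pnorm (joint_op Px Py \<alpha>x \<alpha>y) z)\<^sup>2"
  by (simp add: joint_norm_sq_def pnorm_power2[OF assms(1)] pnorm_power2[OF assms(2)]
      pnorm_power2[OF self_adjoint_pos_def_joint_op[OF assms]] joint_op_def inner_prod_def)

lemma joint_dual_norm_sq_eq:
  assumes "self_adjoint_pos_def Px" "self_adjoint_pos_def Py" "\<alpha>x > 0" "\<alpha>y > 0"
  shows "joint_dual_norm_sq Px Py \<alpha>x \<alpha>y g = (dual_pnorm (joint_op Px Py \<alpha>x \<alpha>y) g)\<^sup>2"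
proof -
  obtain h where h: "g = joint_op Px Py \<alpha>x \<alpha>y h"
    by (rule self_adjoint_pos_def_surj[OF self_adjoint_pos_def_joint_op[OF assms]])
  \<comment> \<open>With the scalar inside \<open>Px\<close>, the dual norm of \<open>fst g\<close>
    is \<open>\<alpha>x\<close> times the norm of \<open>fst h\<close>; squaring and dividing by
    \<open>\<alpha>x\<close> leaves the weight \<open>\<alpha>x\<close> of the joint norm. The same
    holds for y.\<close>
  have "fst g = Px (\<alpha>x *\<^sub>R fst h)" "snd g = Py (\<alpha>y *\<^sub>R snd h)"
    by (simp_all add: h joint_op_def linear_scale[OF self_adjoint_pos_defD(1)[OF assms(1)]]
        linear_scale[OF self_adjoint_pos_defD(1)[OF assms(2)]])
  then have "joint_dual_norm_sq Px Py \<alpha>x \<alpha>y g = joint_norm_sq Px Py \<alpha>x \<alpha>y h"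
    using assms(3,4)
    by (simp add: joint_dual_norm_sq_def joint_norm_sq_def dual_pnorm_image[OF assms(1)]
        dual_pnorm_image[OF assms(2)] pnorm_scaleR[OF assms(1)] pnorm_scaleR[OF assms(2)]
        power_mult_distrib power2_eq_square)
  then show ?thesis
    by (simp add: h joint_norm_sq_eq[OF assms]
        dual_pnorm_image[OF self_adjoint_pos_def_joint_op[OF assms]])
qed


section \<open>One step of the method\<close>

text \<open>With \<open>V = P h\<close> the hypothesis compares the norms of \<open>h - l d\<close>
  and \<open>l d\<close>; after squaring, the terms in \<open>l\<^sup>2\<close> cancel. For positive
  l and nonzero V this makes the step length
  \<open>2 \<langle>V, d\<rangle> / \<parallel>V\<parallel>\<^sup>2\<close> at least
  \<open>1 / l\<close>.\<close>

lemma step_length_bound: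
  assumes "self_adjoint_pos_def P" "dual_pnorm P (V - l *\<^sub>R P d) \<le> l * pnorm P d"
  shows "(dual_pnorm P V)\<^sup>2 \<le> 2 * l * (V \<bullet> d)"
proof -
  note lin = self_adjoint_pos_defD(1)[OF assms(1)]
  obtain h where h: "V = P h" by (rule self_adjoint_pos_def_surj[OF assms(1)])
  have "V - l *\<^sub>R P d = P (h + (- l) *\<^sub>R d)"
    by (simp only: h linear_add[OF lin] linear_scale[OF lin]) simp
  then have "pnorm P (h + (- l) *\<^sub>R d) \<le> l * pnorm P d"
    using assms(2) by (simp add: dual_pnorm_image[OF assms(1)])
  then have "(pnorm P (h + (- l) *\<^sub>R d))\<^sup>2 \<le> (l * pnorm P d)\<^sup>2"
    by (intro power_mono pnorm_nonneg[OF assms(1)])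
  then have "(pnorm P h)\<^sup>2 \<le> 2 * l * (P h \<bullet> d)"
    by (simp only: pnorm_power2_add[OF assms(1)] pnorm_scaleR[OF assms(1)])
      (simp add: power_mult_distrib)
  then show ?thesis by (simp add: h dual_pnorm_image[OF assms(1)])
qed

text \<open>The minimizer p is compared with points on the segment from p to u; dividing by the
  parameter s and letting it tend to 0 from the right gives the first-order optimality
  condition.\<close>

lemma prox_step:
  assumes P: "self_adjoint_pos_def P" and "convex Q" and u: "u \<in> Q"
    and min: "is_arg_min (\<lambda>w. g \<bullet> w + (pnorm P (w - v))\<^sup>2 / 2) (\<lambda>w. w \<in> Q) p"
  shows "g \<bullet> (p - u) \<le> ((pnorm P (v - u))\<^sup>2 - (pnorm P (p - u))\<^sup>2 - (pnorm P (p - v))\<^sup>2) / 2"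
proof -
  note lin = self_adjoint_pos_defD(1)[OF P]
  have pQ: "p \<in> Q" using min by (simp add: is_arg_min_def)
  \<comment> \<open>The prox objective changes by \<open>s * (c + s * k)\<close> from p to
    \<open>p + s (u - p)\<close>: c is its directional derivative towards u and k the quadratic
    coefficient.\<close>
  define c where "c = g \<bullet> (u - p) + P (p - v) \<bullet> (u - p)"
  define k where "k = (pnorm P (u - p))\<^sup>2 / 2"
  have ineq: "0 \<le> c + s * k" if s: "0 < s" "s \<le> 1" for s
  proof -
    define w where "w = p + s *\<^sub>R (u - p)"
    have "w = (1 - s) *\<^sub>R p + s *\<^sub>R u" by (simp add: w_def algebra_simps)
    then have "w \<in> Q" using \<open>convex Q\<close> pQ u s by (simp add: convexD)
    then have "g \<bullet> p + (pnorm P (p - v))\<^sup>2 / 2 \<le> g \<bullet> w + (pnorm P (w - v))\<^sup>2 / 2"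
      using min by (force simp: is_arg_min_def)
    moreover have "(pnorm P (w - v))\<^sup>2
        = (pnorm P (p - v))\<^sup>2 + 2 * s * (P (p - v) \<bullet> (u - p)) + s\<^sup>2 * (pnorm P (u - p))\<^sup>2"
      using pnorm_power2_add[OF P, of "p - v" "s *\<^sub>R (u - p)"]
      by (simp add: w_def pnorm_scaleR[OF P] power_mult_distrib add_diff_eq diff_add_eq)
    moreover have "g \<bullet> w = g \<bullet> p + s * (g \<bullet> (u - p))"
      by (simp add: w_def inner_add_right)
    ultimately have "0 \<le> s * (c + s * k)"
      by (simp add: c_def k_def algebra_simps power2_eq_square)
    then show ?thesis using s by (simp add: zero_le_mult_iff)
  qed
  have "((\<lambda>s. c + s * k) \<longlongrightarrow> c + 0 * k) (at_right 0)"
    by (intro tendsto_intros)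
  moreover have "\<forall>\<^sub>F s in at_right 0. 0 \<le> c + s * k"
    by (rule eventually_mono[OF eventually_at_right_real[of 0 1]]) (auto intro: ineq)
  ultimately have "0 \<le> c + 0 * k" by (rule tendsto_lowerbound) simp
  \<comment> \<open>Writing \<open>u - v\<close> as \<open>(p - v) + (u - p)\<close> turns the cross
    term in c into a difference of three squares.\<close>
  moreover have "(pnorm P (v - u))\<^sup>2
      = (pnorm P (p - v))\<^sup>2 + 2 * (P (p - v) \<bullet> (u - p)) + (pnorm P (p - u))\<^sup>2"
  proof -
    have sym: "pnorm P (- w) = pnorm P w" for w
      using pnorm_scaleR[OF P, of "- 1" w] by simp
    show ?thesis
      using pnorm_power2_add[OF P, of "p - v" "u - p"] sym[of "u - v"] sym[of "u - p"] by simp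
  qed
  ultimately show ?thesis by (simp add: c_def inner_diff_right)
qed

text \<open>Split \<open>z - u\<close> as \<open>(p - u) + (v - p) - (v - z)\<close>. The prox
  inequality handles the first part and leaves a negative square of \<open>p - v\<close>, which pays
  for the second part up to \<open>d\<^sup>2 / 2\<close>. By the factor 2 in a, the third part
  contributes exactly \<open>- d\<^sup>2 / 2\<close>.\<close>

lemma extragradient_step:
  assumes P: "self_adjoint_pos_def P" and "convex Q" "u \<in> Q" and "V \<noteq> 0" "a \<ge> 0"
    and a: "a = 2 * (V \<bullet> (v - z)) / (dual_pnorm P V)\<^sup>2"
    and min: "is_arg_min (\<lambda>w. a * (V \<bullet> w) + (pnorm P (w - v))\<^sup>2 / 2) (\<lambda>w. w \<in> Q) p"
  shows "a * (V \<bullet> (z - u)) \<le> ((pnorm P (v - u))\<^sup>2 - (pnorm P (p - u))\<^sup>2) / 2"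
proof -
  define d where "d = a * dual_pnorm P V"
  have "dual_pnorm P V \<noteq> 0" using \<open>V \<noteq> 0\<close> by (simp add: dual_pnorm_eq_0_iff[OF P])
  then have 1: "a * (V \<bullet> (v - z)) = d\<^sup>2 / 2"
    unfolding d_def power_mult_distrib by (simp add: a power2_eq_square field_simps)
  have "V \<bullet> (v - p) \<le> dual_pnorm P V * pnorm P (p - v)"
    using inner_le_dual_pnorm[OF P, of V "v - p"] pnorm_scaleR[OF P, of "- 1" "v - p"] by simp
  then have 2: "a * (V \<bullet> (v - p)) \<le> d * pnorm P (p - v)"
    using \<open>a \<ge> 0\<close> by (simp add: d_def mult.assoc mult_left_mono)
  have 3: "a * (V \<bullet> (p - u))
      \<le> ((pnorm P (v - u))\<^sup>2 - (pnorm P (p - u))\<^sup>2 - (pnorm P (p - v))\<^sup>2) / 2"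
    using prox_step[OF P \<open>convex Q\<close> \<open>u \<in> Q\<close>, of "a *\<^sub>R V" v p] min by simp
  have "d * pnorm P (p - v) \<le> (d\<^sup>2 + (pnorm P (p - v))\<^sup>2) / 2"
    using sum_squares_bound[of d "pnorm P (p - v)"] by simp
  moreover have "a * (V \<bullet> (z - u)) = a * (V \<bullet> (p - u)) + a * (V \<bullet> (v - p)) - a * (V \<bullet> (v - z))"
    by (simp add: inner_diff_right algebra_simps)
  ultimately show ?thesis using 1 2 3 by (simp add: field_simps)
qed


section \<open>The gap function\<close>

text \<open>By convexity the difference quotients along the segment from x to u are at most
  \<open>f u - f x\<close>. Since C need not extend beyond x, only the limit from the right is
  taken.\<close>

lemma convex_on_above_gderiv:
  assumes "convex_on C f" "u \<in> C" "x \<in> C" "GDERIV f x :> g"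
  shows "f u \<ge> f x + g \<bullet> (u - x)"
proof -
  define h where "h = (\<lambda>s. f (x + s *\<^sub>R (u - x)))"
  have "((\<lambda>s. x + s *\<^sub>R (u - x)) has_derivative (\<lambda>s. s *\<^sub>R (u - x))) (at 0)"
    by (auto intro!: derivative_eq_intros)
  moreover have "(f has_derivative (\<lambda>w. w \<bullet> g)) (at (x + 0 *\<^sub>R (u - x)))"
    using assms(4) by (simp add: gderiv_def)
  ultimately have "(h has_derivative (\<lambda>s. (s *\<^sub>R (u - x)) \<bullet> g)) (at 0)"
    unfolding h_def by (rule has_derivative_compose)
  then have "(h has_real_derivative (g \<bullet> (u - x))) (at 0)"
    by (rule has_derivative_imp_has_field_derivative) (simp add: inner_commute)
  then have "((\<lambda>s. (h s - h 0) / (s - 0)) \<longlongrightarrow> g \<bullet> (u - x)) (at_right 0)"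
    unfolding has_field_derivative_iff
    by (simp add: tendsto_within_subset[OF _ subset_UNIV])
  moreover have "\<forall>\<^sub>F s in at_right 0. (h s - h 0) / (s - 0) \<le> f u - f x"
  proof -
    have "(h s - h 0) / (s - 0) \<le> f u - f x" if "s \<in> {0<..<1}" for s
    proof -
      have "x + s *\<^sub>R (u - x) = (1 - s) *\<^sub>R x + s *\<^sub>R u" by (simp add: algebra_simps)
      then have "h s \<le> (1 - s) * f x + s * f u"
        using convex_onD[OF assms(1), of s x u] that assms(2,3) by (simp add: h_def)
      then show ?thesis using that by (simp add: h_def field_simps)
    qed
    then show ?thesis
      by (rule eventually_mono[OF eventually_at_right_real[of 0 1], rotated]) simp_all
  qed
  ultimately have "g \<bullet> (u - x) \<le> f u - f x"
    by (intro tendsto_upperbound) auto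
  then show ?thesis by simp
qed

text \<open>Justifies the definite descriptions in \<open>grad_x\<close> and \<open>grad_y\<close>
  at points of differentiability.\<close>

lemma gderiv_the:
  fixes f :: "'a::euclidean_space \<Rightarrow> real"
  assumes "f differentiable (at x)"
  shows "GDERIV f x :> (THE g. GDERIV f x :> g)"
proof (rule theI')
  obtain f' where f': "(f has_derivative f') (at x)"
    using assms by (auto simp: differentiable_def)
  then have lin: "linear f'" by (rule has_derivative_linear)
  \<comment> \<open>Riesz representer: \<open>f' u\<close> is \<open>f' u \<bullet> 1\<close>, and
    the adjoint moves \<open>f'\<close> to the other side.\<close>
  define g where "g = adjoint f' 1"
  have "f' = (\<lambda>u. u \<bullet> g)"
    using adjoint_works[OF lin, of _ 1] by (simp add: g_def fun_eq_iff)
  then have "GDERIV f x :> g" using f' by (simp add: gderiv_def)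
  moreover have "g' = g" if "GDERIV f x :> g'" for g'
  proof -
    have "(\<lambda>u. u \<bullet> g') = (\<lambda>u. u \<bullet> g)"
      using that \<open>GDERIV f x :> g\<close> unfolding gderiv_def by (rule has_derivative_unique)
    then have "\<forall>u. u \<bullet> g' = u \<bullet> g" by (simp add: fun_eq_iff)
    then show ?thesis by (simp only: vector_eq_ldot)
  qed
  ultimately show "\<exists>!g. GDERIV f x :> g" by blast
qed

lemma gderiv_grad_x:
  fixes f :: "'a::euclidean_space \<times> 'b::euclidean_space \<Rightarrow> real"
  assumes "f differentiable (at z)"
  shows "GDERIV (\<lambda>u. f (u, snd z)) (fst z) :> grad_x f z"
  unfolding grad_x_def
proof (rule gderiv_the)
  have "(\<lambda>u. (u, snd z)) differentiable (at (fst z))"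
    unfolding differentiable_def by (intro exI) (auto intro!: derivative_eq_intros)
  then show "(\<lambda>u. f (u, snd z)) differentiable (at (fst z))"
    by (rule differentiable_compose[of f, rotated]) (use assms in simp)
qed

lemma gderiv_grad_y:
  fixes f :: "'a::euclidean_space \<times> 'b::euclidean_space \<Rightarrow> real"
  assumes "f differentiable (at z)"
  shows "GDERIV (\<lambda>w. f (fst z, w)) (snd z) :> grad_y f z"
  unfolding grad_y_def
proof (rule gderiv_the)
  have "(\<lambda>w. (fst z, w)) differentiable (at (snd z))"
    unfolding differentiable_def by (intro exI) (auto intro!: derivative_eq_intros)
  then show "(\<lambda>w. f (fst z, w)) differentiable (at (snd z))"
    by (rule differentiable_compose[of f, rotated]) (use assms in simp)
qed

section \<open>Extended-valued convex functions on their effective domains\<close>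

lemma eff_dom_ereal:
  assumes "proper_closed_convex \<psi>" "u \<in> eff_dom \<psi>"
  shows "\<psi> u = ereal (real_of_ereal (\<psi> u))"
  using assms by (cases "\<psi> u") (auto simp: proper_closed_convex_def eff_dom_def)

lemma convex_on_eff_dom:
  assumes "proper_closed_convex \<psi>"
  shows "convex_on (eff_dom \<psi>) (\<lambda>u. real_of_ereal (\<psi> u))"
proof -
  \<comment> \<open>A convex combination of two epigraph points stays in the epigraph. The bound is
    finite, so it yields both the convexity of the domain and, once finiteness is known, the
    real-valued inequality.\<close>
  have *: "\<psi> ((1 - t) *\<^sub>R u + t *\<^sub>R w)
      \<le> ereal ((1 - t) * real_of_ereal (\<psi> u) + t * real_of_ereal (\<psi> w))"
    if "u \<in> eff_dom \<psi>" "w \<in> eff_dom \<psi>" "0 \<le> t" "t \<le> 1" for u w t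
  proof -
    have "(u, real_of_ereal (\<psi> u)) \<in> ext_epigraph \<psi>" "(w, real_of_ereal (\<psi> w)) \<in> ext_epigraph \<psi>"
      using that(1,2)[THEN eff_dom_ereal[OF assms], THEN eq_refl] by (simp_all add: ext_epigraph_def)
    moreover have "convex (ext_epigraph \<psi>)" using assms by (simp add: proper_closed_convex_def)
    ultimately have "(1 - t) *\<^sub>R (u, real_of_ereal (\<psi> u)) + t *\<^sub>R (w, real_of_ereal (\<psi> w))
        \<in> ext_epigraph \<psi>"
      using that(3,4) by (intro convexD) auto
    then show ?thesis by (simp add: ext_epigraph_def)
  qed
  have dom: "(1 - t) *\<^sub>R u + t *\<^sub>R w \<in> eff_dom \<psi>"
    if "u \<in> eff_dom \<psi>" "w \<in> eff_dom \<psi>" "0 \<le> t" "t \<le> 1" for u w t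
    using *[OF that] by (auto simp: eff_dom_def)
  show ?thesis
  proof (rule convex_onI)
    show "convex (eff_dom \<psi>)" using dom by (simp add: convex_alt)
    show "real_of_ereal (\<psi> ((1 - t) *\<^sub>R u + t *\<^sub>R w))
        \<le> (1 - t) * real_of_ereal (\<psi> u) + t * real_of_ereal (\<psi> w)"
      if "0 < t" "t < 1" "u \<in> eff_dom \<psi>" "w \<in> eff_dom \<psi>" for t u w
      using order_trans[OF eq_refl[OF eff_dom_ereal[OF assms dom, symmetric]] *, of u w t] that
      by simp
  qed
qed

lemma subdifferentialD:
  assumes "proper_closed_convex \<psi>" "g \<in> subdifferential \<psi> u" "w \<in> eff_dom \<psi>"
  shows "real_of_ereal (\<psi> w) \<ge> real_of_ereal (\<psi> u) + g \<bullet> (w - u)"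
proof -
  have "u \<in> eff_dom \<psi>" "\<psi> w \<ge> \<psi> u + ereal (g \<bullet> (w - u))"
    using assms(2) by (auto simp: subdifferential_def)
  moreover obtain r s where "\<psi> u = ereal r" "\<psi> w = ereal s"
    using eff_dom_ereal[OF assms(1)] \<open>u \<in> eff_dom \<psi>\<close> assms(3) by blast
  ultimately show ?thesis by simp
qed

section \<open>Convexity of the gap integrand and its bound by the operator\<close>

lemma convex_feasible:
  assumes "convex_concave I" shows "convex (feasible I)"
  unfolding feasible_def using assms
  by (intro convex_Times) (auto simp: convex_concave_def intro!: convex_on_imp_convex convex_on_eff_dom)

text \<open>For fixed u the difference separates, up to a constant, into a convex function of
  \<open>fst w\<close> and a convex function of \<open>snd w\<close>. This is what Jensen's
  inequality needs.\<close>

lemma convex_on_saddle_obj_diff: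
  assumes "convex_concave I" "u \<in> feasible I"
  shows "convex_on (feasible I) (\<lambda>w. saddle_obj I (fst w) (snd u) - saddle_obj I (fst u) (snd w))"
proof (rule convex_onI[OF _ convex_feasible[OF assms(1)]])
  fix t :: real and w w' assume t: "0 < t" "t < 1" and w: "w \<in> feasible I" "w' \<in> feasible I"
  let ?fx = "\<lambda>x. obj_f I (x, snd u)" and ?fy = "\<lambda>y. - obj_f I (fst u, y)"
  have cx: "convex_on (eff_dom (psi_x I)) (\<lambda>x. ?fx x + real_of_ereal (psi_x I x))"
    using assms by (intro convex_on_add convex_on_eff_dom) (auto simp: convex_concave_def feasible_def)
  have cy: "convex_on (eff_dom (psi_y I)) (\<lambda>y. ?fy y + real_of_ereal (psi_y I y))"
    using assms by (intro convex_on_add convex_on_eff_dom)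
      (auto simp: convex_concave_def feasible_def concave_on_def)
  have "fst w \<in> eff_dom (psi_x I)" "fst w' \<in> eff_dom (psi_x I)"
    "snd w \<in> eff_dom (psi_y I)" "snd w' \<in> eff_dom (psi_y I)"
    using w by (auto simp: feasible_def)
  then show "saddle_obj I (fst ((1 - t) *\<^sub>R w + t *\<^sub>R w')) (snd u)
      - saddle_obj I (fst u) (snd ((1 - t) *\<^sub>R w + t *\<^sub>R w'))
    \<le> (1 - t) * (saddle_obj I (fst w) (snd u) - saddle_obj I (fst u) (snd w))
      + t * (saddle_obj I (fst w') (snd u) - saddle_obj I (fst u) (snd w'))"
    using convex_onD[OF cx, of t "fst w" "fst w'"] convex_onD[OF cy, of t "snd w" "snd w'"] t
    by (simp add: saddle_obj_def algebra_simps)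
qed

text \<open>Add the gradient inequalities of \<open>f(\<cdot>, y)\<close> and
  \<open>- f(x, \<cdot>)\<close> at z and the subgradient inequalities of both
  \<open>\<psi>\<close>; the value of f at z cancels.\<close>

lemma saddle_obj_diff_le:
  assumes "convex_concave I" "obj_f I differentiable (at z)" "u \<in> feasible I"
    and "fst g \<in> subdifferential (psi_x I) (fst z)" "snd g \<in> subdifferential (psi_y I) (snd z)"
  shows "saddle_obj I (fst z) (snd u) - saddle_obj I (fst u) (snd z) \<le> V_psi I z g \<bullet> (z - u)"
proof -
  have dom: "fst z \<in> eff_dom (psi_x I)" "snd z \<in> eff_dom (psi_y I)"
    "fst u \<in> eff_dom (psi_x I)" "snd u \<in> eff_dom (psi_y I)"
    using assms(3-5) by (auto simp: subdifferential_def feasible_def)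
  have "GDERIV (\<lambda>w. - obj_f I (fst z, w)) (snd z) :> - grad_y (obj_f I) z"
    by (intro GDERIV_minus gderiv_grad_y assms(2))
  then have "- obj_f I (fst z, snd u) \<ge> - obj_f I (fst z, snd z) + (- grad_y (obj_f I) z) \<bullet> (snd u - snd z)"
    using assms(1) dom
    by (intro convex_on_above_gderiv[of "eff_dom (psi_y I)" "\<lambda>w. - obj_f I (fst z, w)"])
      (auto simp: convex_concave_def concave_on_def)
  moreover have "obj_f I (fst u, snd z) \<ge> obj_f I (fst z, snd z) + grad_x (obj_f I) z \<bullet> (fst u - fst z)"
    using assms(1,2) dom
    by (intro convex_on_above_gderiv[of "eff_dom (psi_x I)" "\<lambda>w. obj_f I (w, snd z)"] gderiv_grad_x)
      (auto simp: convex_concave_def)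
  moreover have "real_of_ereal (psi_x I (fst u)) \<ge> real_of_ereal (psi_x I (fst z)) + fst g \<bullet> (fst u - fst z)"
    "real_of_ereal (psi_y I (snd u)) \<ge> real_of_ereal (psi_y I (snd z)) + snd g \<bullet> (snd u - snd z)"
    using assms(1,4,5) dom by (auto simp: convex_concave_def intro!: subdifferentialD)
  ultimately show ?thesis
    by (simp add: saddle_obj_def V_psi_def inner_prod_def inner_add_left inner_diff_left inner_diff_right)
qed


section \<open>Communication complexity\<close>

lemma local_solution_dual_bound:
  assumes Px: "self_adjoint_pos_def Px" and Py: "self_adjoint_pos_def Py"
    and pos: "\<alpha>x > 0" "\<alpha>y > 0" and prod: "\<alpha>x * \<alpha>y = Lxy\<^sup>2"
    and smooth: "smooth_coupling Px Py Lx Lxy Ly I" and v: "v \<in> feasible I"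
    and sol: "local_solution Px Py \<alpha>x \<alpha>y 2 I v z g"
  defines "B \<equiv> joint_op Px Py \<alpha>x \<alpha>y"
  shows "dual_pnorm B (V_psi I z g - 2 *\<^sub>R B (v - z)) \<le> 2 * pnorm B (v - z)"
proof -
  note B = self_adjoint_pos_def_joint_op[OF Px Py pos, folded B_def]
  note joint_eqs = joint_norm_sq_eq[OF Px Py pos, folded B_def]
    joint_dual_norm_sq_eq[OF Px Py pos, folded B_def]
  \<comment> \<open>\<open>e\<close> collects the residuals of the two local problems;
    \<open>d\<close> is the change in each partial gradient when the other agent's old point is
    replaced by the new one.\<close>
  define e where "e = (grad_x (obj_f I) (fst z, snd v) + (\<alpha>x * 2) *\<^sub>R Px (fst z - fst v) + fst g,
    - grad_y (obj_f I) (fst v, snd z) + (\<alpha>y * 2) *\<^sub>R Py (snd z - snd v) + snd g)"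
  define d where "d = (grad_x (obj_f I) z - grad_x (obj_f I) (fst z, snd v),
    - (grad_y (obj_f I) z - grad_y (obj_f I) (fst v, snd z)))"
  have sym: "pnorm Px (- x) = pnorm Px x" "pnorm Py (- y) = pnorm Py y" for x y
    using pnorm_scaleR[OF Px, of "- 1" x] pnorm_scaleR[OF Py, of "- 1" y] by simp_all
  define p q where "p = pnorm Px (fst (v - z))" and "q = pnorm Py (snd (v - z))"
  have pq: "pnorm Px (fst z - fst v) = p" "pnorm Py (snd z - snd v) = q"
    using sym(1)[of "fst v - fst z"] sym(2)[of "snd v - snd z"] by (simp_all add: p_def q_def)
  have n: "(pnorm B (v - z))\<^sup>2 = \<alpha>x * p\<^sup>2 + \<alpha>y * q\<^sup>2"
    by (simp add: joint_eqs(1)[symmetric] joint_norm_sq_def p_def q_def)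
  have zdom: "fst z \<in> eff_dom (psi_x I)" "snd z \<in> eff_dom (psi_y I)"
    using sol by (auto simp: local_solution_def subdifferential_def)
  have vdom: "fst v \<in> eff_dom (psi_x I)" "snd v \<in> eff_dom (psi_y I)"
    using v by (auto simp: feasible_def)
  have "dual_pnorm B e \<le> pnorm B (v - z)"
  proof (rule power2_le_imp_le[OF _ pnorm_nonneg[OF B]])
    \<comment> \<open>For \<open>\<lambda> = 2\<close> the tolerance
      \<open>\<alpha>x * \<lambda> / 2\<close> is just \<open>\<alpha>x\<close>.\<close>
    have "dual_pnorm Px (fst e) \<le> \<alpha>x * p" "dual_pnorm Py (snd e) \<le> \<alpha>y * q"
      using sol by (simp_all add: local_solution_def e_def pq)
    then have "(dual_pnorm Px (fst e))\<^sup>2 \<le> (\<alpha>x * p)\<^sup>2" "(dual_pnorm Py (snd e))\<^sup>2 \<le> (\<alpha>y * q)\<^sup>2"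
      by (simp_all add: power_mono dual_pnorm_nonneg[OF Px] dual_pnorm_nonneg[OF Py])
    then have "(dual_pnorm Px (fst e))\<^sup>2 / \<alpha>x \<le> \<alpha>x * p\<^sup>2" "(dual_pnorm Py (snd e))\<^sup>2 / \<alpha>y \<le> \<alpha>y * q\<^sup>2"
      using pos by (simp_all add: field_simps power2_eq_square)
    then show "(dual_pnorm B e)\<^sup>2 \<le> (pnorm B (v - z))\<^sup>2"
      by (simp add: n joint_eqs(2)[symmetric] joint_dual_norm_sq_def)
  qed
  moreover have "dual_pnorm B d \<le> pnorm B (v - z)"
  proof (rule power2_le_imp_le[OF _ pnorm_nonneg[OF B]])
    have px0: "pnorm Px 0 = 0" "pnorm Py 0 = 0"
      by (simp_all add: pnorm_eq_0_iff[OF Px] pnorm_eq_0_iff[OF Py])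
    have sx: "dual_pnorm Px (grad_x (obj_f I) (x', y') - grad_x (obj_f I) (x, y))
          \<le> Lx * pnorm Px (x' - x) + Lxy * pnorm Py (y' - y)"
      and sy: "dual_pnorm Py (grad_y (obj_f I) (x', y') - grad_y (obj_f I) (x, y))
          \<le> Lxy * pnorm Px (x' - x) + Ly * pnorm Py (y' - y)"
      if "x \<in> eff_dom (psi_x I)" "x' \<in> eff_dom (psi_x I)" "y \<in> eff_dom (psi_y I)" "y' \<in> eff_dom (psi_y I)"
      for x x' y y'
      using smooth that unfolding smooth_coupling_def by blast+
    \<comment> \<open>In each difference only the other agent's coordinate moves, so
      \<open>Lx\<close> and \<open>Ly\<close> multiply a zero norm and only \<open>Lxy\<close>
      survives.\<close>
    have "dual_pnorm Px (fst d) \<le> Lxy * q" "dual_pnorm Py (snd d) \<le> Lxy * p"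
      using sx[of "fst z" "fst z" "snd v" "snd z"] sy[of "fst v" "fst z" "snd z" "snd z"] zdom vdom
      by (simp_all only: d_def fst_conv snd_conv dual_pnorm_minus[OF Py] pq px0 diff_self prod.collapse)
        simp_all
    then have "(dual_pnorm Px (fst d))\<^sup>2 \<le> (Lxy * q)\<^sup>2" "(dual_pnorm Py (snd d))\<^sup>2 \<le> (Lxy * p)\<^sup>2"
      by (simp_all add: power_mono dual_pnorm_nonneg[OF Px] dual_pnorm_nonneg[OF Py])
    \<comment> \<open>Since \<open>Lxy\<^sup>2 = \<alpha>x * \<alpha>y\<close>, dividing by one
      weight leaves the other: the two error terms swap roles and add up to the same joint
      norm.\<close>
    then have "(dual_pnorm Px (fst d))\<^sup>2 / \<alpha>x \<le> \<alpha>y * q\<^sup>2" "(dual_pnorm Py (snd d))\<^sup>2 / \<alpha>y \<le> \<alpha>x * p\<^sup>2"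
      using pos by (simp_all add: field_simps power_mult_distrib prod[symmetric])
    then show "(dual_pnorm B d)\<^sup>2 \<le> (pnorm B (v - z))\<^sup>2"
      by (simp add: n joint_eqs(2)[symmetric] joint_dual_norm_sq_def)
  qed
  moreover have "V_psi I z g - 2 *\<^sub>R B (v - z) = e + d"
  proof -
    have "Px (fst v - fst z) = - Px (fst z - fst v)" "Py (snd v - snd z) = - Py (snd z - snd v)"
      using linear_diff[OF self_adjoint_pos_defD(1)[OF Px]] linear_diff[OF self_adjoint_pos_defD(1)[OF Py]]
      by simp_all
    then show ?thesis
      by (simp add: V_psi_def e_def d_def B_def joint_op_def mult.commute)
  qed
  ultimately show ?thesis
    using dual_pnorm_triangle[OF B, of e d] by simp
qed

text \<open>Either no \<open>V\<close> vanishes in the first T iterations and the averaging argument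
  applies, or the method has stopped at an exact saddle point. The comparison point u is arbitrary
  in Q; the trust region enters only when the supremum is taken.\<close>

lemma dm_sp_gap_bound:
  assumes Px: "self_adjoint_pos_def Px" and Py: "self_adjoint_pos_def Py"
    and pos: "\<alpha>x > 0" "\<alpha>y > 0" and prod: "\<alpha>x * \<alpha>y = Lxy\<^sup>2"
    and cc: "convex_concave I" and smooth: "smooth_coupling Px Py Lx Lxy Ly I"
    and init: "init_pt I \<in> feasible I"
    and traj: "dm_sp_trajectory Px Py \<alpha>x \<alpha>y (\<lambda>_. 2) I v z g a zbar"
    and "T > 0" and u: "u \<in> feasible I"
  shows "zbar T \<in> feasible I"
    and "saddle_obj I (fst (zbar T)) (snd u) - saddle_obj I (fst u) (snd (zbar T))
      \<le> joint_norm_sq Px Py \<alpha>x \<alpha>y (init_pt I - u) / T"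
proof -
  define B where "B = joint_op Px Py \<alpha>x \<alpha>y"
  note B = self_adjoint_pos_def_joint_op[OF Px Py pos, folded B_def]
  note joint_eqs = joint_norm_sq_eq[OF Px Py pos, folded B_def]
    joint_dual_norm_sq_eq[OF Px Py pos, folded B_def]
  define V where "V = (\<lambda>t. V_psi I (z (Suc t)) (g (Suc t)))"
  define G where "G = (\<lambda>w. saddle_obj I (fst w) (snd u) - saddle_obj I (fst u) (snd w))"
  \<comment> \<open>The step length \<open>a (Suc t)\<close> and the point \<open>v (Suc t)\<close>
    are constrained by the template exactly when \<open>reached\<close> holds at
    \<open>Suc t\<close>, hence the index in the facts below.\<close>
  have reached_Suc: "reached I z g (Suc t) \<longleftrightarrow> reached I z g t \<and> V t \<noteq> 0" for t
    by (auto simp: reached_def V_def less_Suc_eq)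
  have v0: "v 0 = init_pt I"
    using traj by (simp add: dm_sp_trajectory_def)
  have sol: "local_solution Px Py \<alpha>x \<alpha>y 2 I (v t) (z (Suc t)) (g (Suc t))"
    and stop: "V t = 0 \<Longrightarrow> k \<ge> Suc t \<Longrightarrow> zbar k = z (Suc t)"
    and a_eq: "V t \<noteq> 0 \<Longrightarrow> a (Suc t) = 2 * (V t \<bullet> (v t - z (Suc t))) / (dual_pnorm B (V t))\<^sup>2"
    and zbar_eq: "V t \<noteq> 0 \<Longrightarrow>
      zbar (Suc t) = (1 / (\<Sum>i=1..Suc t. a i)) *\<^sub>R (\<Sum>i=1..Suc t. a i *\<^sub>R z i)"
    and v_min: "V t \<noteq> 0 \<Longrightarrow> is_arg_min (\<lambda>w. a (Suc t) * (V t \<bullet> w) + (pnorm B (w - v t))\<^sup>2 / 2)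
      (\<lambda>w. w \<in> feasible I) (v (Suc t))"
    if "reached I z g t" for t k
    using traj that unfolding dm_sp_trajectory_def joint_eqs V_def Let_def by meson+
  have v_feasible: "v t \<in> feasible I" if "reached I z g t" for t
  proof (cases t)
    case 0
    then show ?thesis using init v0 by simp
  next
    case (Suc s)
    then show ?thesis using v_min[of s] that by (simp add: reached_Suc is_arg_min_def)
  qed
  have z_feasible: "z (Suc t) \<in> feasible I"
    and G_le: "G (z (Suc t)) \<le> V t \<bullet> (z (Suc t) - u)" if "reached I z g t" for t
  proof -
    have sub: "fst (g (Suc t)) \<in> subdifferential (psi_x I) (fst (z (Suc t)))"
      "snd (g (Suc t)) \<in> subdifferential (psi_y I) (snd (z (Suc t)))"
      using sol[OF that] by (simp_all add: local_solution_def)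
    then show f: "z (Suc t) \<in> feasible I"
      by (auto simp: subdifferential_def feasible_def mem_Times_iff)
    show "G (z (Suc t)) \<le> V t \<bullet> (z (Suc t) - u)"
      unfolding G_def V_def using smooth f sub
      by (intro saddle_obj_diff_le[OF cc _ u]) (auto simp: smooth_coupling_def)
  qed
  have a_ge: "a (Suc t) \<ge> 1 / 2" if "reached I z g (Suc t)" for t
  proof -
    have r: "reached I z g t" "V t \<noteq> 0" using that by (simp_all add: reached_Suc)
    \<comment> \<open>\<open>step_length_bound\<close> with l = 2, the value of
      \<open>\<lambda>\<close>.\<close>
    have "(dual_pnorm B (V t))\<^sup>2 \<le> 2 * 2 * (V t \<bullet> (v t - z (Suc t)))"
      using local_solution_dual_bound[OF Px Py pos prod smooth v_feasible[OF r(1)] sol[OF r(1)]]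
      by (intro step_length_bound[OF B]) (simp add: B_def V_def)
    moreover have "(dual_pnorm B (V t))\<^sup>2 > 0" using r(2) by (simp add: dual_pnorm_eq_0_iff[OF B])
    ultimately show ?thesis unfolding a_eq[OF r] by (simp add: field_simps)
  qed
  have step: "a (Suc t) * G (z (Suc t)) \<le> ((pnorm B (v t - u))\<^sup>2 - (pnorm B (v (Suc t) - u))\<^sup>2) / 2"
    if "reached I z g (Suc t)" for t
  proof -
    have r: "reached I z g t" "V t \<noteq> 0" using that by (simp_all add: reached_Suc)
    have "a (Suc t) * G (z (Suc t)) \<le> a (Suc t) * (V t \<bullet> (z (Suc t) - u))"
      using a_ge[OF that] G_le[OF r(1)] by (intro mult_left_mono) auto
    also have "\<dots> \<le> ((pnorm B (v t - u))\<^sup>2 - (pnorm B (v (Suc t) - u))\<^sup>2) / 2"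
      using a_ge[OF that] a_eq[OF r] v_min[OF r]
      by (intro extragradient_step[OF B convex_feasible[OF cc] u r(2)]) auto
    finally show ?thesis .
  qed
  have telescope: "(\<Sum>i=1..t. a i * G (z i)) \<le> ((pnorm B (init_pt I - u))\<^sup>2 - (pnorm B (v t - u))\<^sup>2) / 2"
    if "reached I z g t" for t
    using that
  proof (induction t)
    case 0
    show ?case by (simp add: v0)
  next
    case (Suc t)
    then have "(\<Sum>i=1..t. a i * G (z i)) \<le> ((pnorm B (init_pt I - u))\<^sup>2 - (pnorm B (v t - u))\<^sup>2) / 2"
      by (simp add: reached_Suc)
    then show ?case using step[OF Suc.prems] by (simp add: field_simps)
  qed
  have "zbar T \<in> feasible I \<and> G (zbar T) \<le> (pnorm B (init_pt I - u))\<^sup>2 / T"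
  proof (cases "reached I z g T")
    case True
    define A where "A = (\<Sum>i=1..T. a i)"
    have reached_le: "reached I z g i" if "i \<le> T" for i
      using True that by (simp add: reached_def)
    have a_z: "a i \<ge> 1 / 2 \<and> z i \<in> feasible I" if i: "i \<in> {1..T}" for i
    proof -
      obtain s where "i = Suc s" "Suc s \<le> T" using i by (cases i) auto
      then show ?thesis using a_ge[of s] z_feasible[of s] reached_le by simp
    qed
    have "(\<Sum>i=1..T. 1 / 2) \<le> A" unfolding A_def using a_z by (intro sum_mono) blast
    \<comment> \<open>Together with the factor 1/2 from telescoping, this lower bound leaves exactly
      the squared distance divided by T.\<close>
    then have A: "A \<ge> T / 2" by simp
    with \<open>T > 0\<close> have "A > 0" by linarith
    have zbar: "zbar T = (\<Sum>i=1..T. (a i / A) *\<^sub>R z i)"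
    proof -
      obtain s where "T = Suc s" using \<open>T > 0\<close> by (cases T) auto
      then have "zbar T = (1 / A) *\<^sub>R (\<Sum>i=1..T. a i *\<^sub>R z i)"
        using zbar_eq[of s] True by (simp add: A_def reached_Suc)
      then show ?thesis by (simp add: scaleR_sum_right)
    qed
    have weights: "(\<Sum>i=1..T. a i / A) = 1" "\<And>i. i \<in> {1..T} \<Longrightarrow> a i / A \<ge> 0"
    proof -
      show "(\<Sum>i=1..T. a i / A) = 1"
        using \<open>A > 0\<close> by (simp add: A_def sum_divide_distrib[symmetric])
      show "a i / A \<ge> 0" if "i \<in> {1..T}" for i
        using a_z[OF that] \<open>A > 0\<close> by simp
    qed
    have "zbar T \<in> feasible I"
      unfolding zbar using weights a_z by (intro convex_sum convex_feasible[OF cc]) auto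
    \<comment> \<open>Jensen's inequality with weights \<open>a i / A\<close>.\<close>
    have "G (zbar T) \<le> (\<Sum>i=1..T. a i / A * G (z i))"
      unfolding zbar
    proof (rule convex_on_sum[OF _ _ convex_on_saddle_obj_diff[OF cc u, folded G_def] weights(1)])
      show "{1..T} \<noteq> {}" using \<open>T > 0\<close> by simp
    qed (simp_all add: weights(2) a_z del: atLeastAtMost_iff One_nat_def)
    also have "\<dots> = (\<Sum>i=1..T. a i * G (z i)) / A"
      by (simp add: sum_divide_distrib)
    also have "\<dots> \<le> ((pnorm B (init_pt I - u))\<^sup>2 / 2) / A"
    proof (rule divide_right_mono)
      show "(\<Sum>i=1..T. a i * G (z i)) \<le> (pnorm B (init_pt I - u))\<^sup>2 / 2"
        using telescope[OF True] zero_le_power2[of "pnorm B (v T - u)"] by argo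
      show "0 \<le> A" using \<open>A > 0\<close> by simp
    qed
    also have "\<dots> \<le> ((pnorm B (init_pt I - u))\<^sup>2 / 2) / (T / 2)"
      using A \<open>A > 0\<close> \<open>T > 0\<close> by (intro divide_left_mono) simp_all
    finally show ?thesis using \<open>zbar T \<in> feasible I\<close> by simp
  next
    case False
    \<comment> \<open>The first zero of \<open>V\<close> is needed because only there is the
      iteration known to be reached. From then on the candidate is frozen at
      \<open>z (Suc s)\<close>, where \<open>G\<close> is at most 0.\<close>
    define s where "s = (LEAST s. V s = 0)"
    obtain s' where s': "s' < T" "V s' = 0" using False by (auto simp: reached_def V_def)
    have "V s = 0" unfolding s_def using s'(2) by (rule LeastI)
    have "s < T" using s' Least_le[of "\<lambda>s. V s = 0" s'] by (simp add: s_def)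
    have r: "reached I z g s"
      unfolding reached_def
    proof (intro allI impI)
      show "V_psi I (z (Suc i)) (g (Suc i)) \<noteq> 0" if "i < s" for i
        using not_less_Least[OF that[unfolded s_def]] by (simp add: V_def)
    qed
    have "zbar T = z (Suc s)" using stop[OF r \<open>V s = 0\<close>] \<open>s < T\<close> by simp
    moreover have "G (z (Suc s)) \<le> 0" using G_le[OF r] \<open>V s = 0\<close> by simp
    moreover have "0 \<le> (pnorm B (init_pt I - u))\<^sup>2 / T" by simp
    ultimately show ?thesis using z_feasible[OF r] by (metis order_trans)
  qed
  then show "zbar T \<in> feasible I"
    and "saddle_obj I (fst (zbar T)) (snd u) - saddle_obj I (fst u) (snd (zbar T))
      \<le> joint_norm_sq Px Py \<alpha>x \<alpha>y (init_pt I - u) / T"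
    by (simp_all add: G_def joint_eqs)
qed

theorem theorem3p1:
  fixes Px :: "real ^ 'n \<Rightarrow> real ^ 'n" and Py :: "real ^ 'm \<Rightarrow> real ^ 'm"
    and Lx Lxy Ly Dx Dy \<epsilon> \<alpha>x \<alpha>y :: real
    and M :: "(real ^ 'n, real ^ 'm) dist_method"
    and \<C> :: "(real ^ 'n, real ^ 'm) saddle_instance set"
  assumes "self_adjoint_pos_def Px" and "self_adjoint_pos_def Py"
    and "Lx > 0" and "Lxy > 0" and "Ly > 0" and "Dx > 0" and "Dy > 0" and "\<epsilon> > 0"
    and "\<alpha>x = Lxy * Dy / Dx" and "\<alpha>y = Lxy * Dx / Dy"
    and "\<C> \<subseteq> saddle_class Px Py Lx Lxy Ly Dx Dy"
    and "\<forall>I\<in>\<C>. runs_dm_sp Px Py \<alpha>x \<alpha>y (\<lambda>_. 2) M I"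
  shows "ereal_of_enat (comm_complexity Px Py Dx Dy \<epsilon> M \<C>)
           \<le> ereal (2 + 4 * (Lxy * Dx * Dy / \<epsilon>))"
proof -
  define c where "c = Lxy * Dx * Dy"
  \<comment> \<open>The least number of iterations with \<open>2 * c / T \<le> \<epsilon>\<close>.
    Rounding up costs at most one iteration, that is two rounds: the additive 2 of the
    bound.\<close>
  define T where "T = nat \<lceil>2 * c / \<epsilon>\<rceil>"
  have pos: "\<alpha>x > 0" "\<alpha>y > 0" "c > 0" using assms by (simp_all add: c_def)
  have prod: "\<alpha>x * \<alpha>y = Lxy\<^sup>2" using assms by (simp add: power2_eq_square)
  have T: "2 * c / \<epsilon> \<le> T" "T \<le> 2 * c / \<epsilon> + 1" "T > 0"
    using pos(3) \<open>\<epsilon> > 0\<close> by (auto simp: T_def)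
  have "comm_time Px Py Dx Dy \<epsilon> M I \<le> enat (2 * T)" if IC: "I \<in> \<C>" for I
  proof -
    have I: "convex_concave I" "smooth_coupling Px Py Lx Lxy Ly I" "init_pt I \<in> feasible I"
      using assms(11) IC by (auto simp: saddle_class_def)
    obtain v z g a zbar where traj: "dm_sp_trajectory Px Py \<alpha>x \<alpha>y (\<lambda>_. 2) I v z g a zbar"
      and cand: "\<And>t. candidate_after M I (2 * t + 2) = zbar (Suc t)"
      using assms(12) IC unfolding runs_dm_sp_def by blast
    note bound = dm_sp_gap_bound[OF assms(1,2) pos(1,2) prod I traj T(3)]
    \<comment> \<open>The candidate after 2t + 2 rounds is \<open>zbar (Suc t)\<close>, so t is T -
      1.\<close>
    have "candidate_after M I (2 * T) = zbar T"
      using cand[of "T - 1"] T(3) by (cases T) auto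
    moreover have "eps_saddle_point Px Py Dx Dy \<epsilon> I (zbar T)"
      unfolding eps_saddle_point_def saddle_gap_def
    proof (intro conjI SUP_least)
      show "zbar T \<in> feasible I" by (rule bound(1)[OF I(3)])
      fix u assume u: "u \<in> trust_region Px Py Dx Dy I \<inter> feasible I"
      have "joint_norm_sq Px Py \<alpha>x \<alpha>y (init_pt I - u) \<le> \<alpha>x * Dx\<^sup>2 + \<alpha>y * Dy\<^sup>2"
        unfolding joint_norm_sq_def using u pos
        by (intro add_mono mult_left_mono power_mono pnorm_nonneg assms(1,2))
          (auto simp: trust_region_def)
      \<comment> \<open>The choice of weights balances the two agents:
        \<open>\<alpha>x * Dx\<^sup>2\<close> and \<open>\<alpha>y * Dy\<^sup>2\<close> both equal
        c.\<close>
      also have "\<dots> = 2 * c" using assms(6,7,9,10) by (simp add: c_def power2_eq_square)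
      finally have "joint_norm_sq Px Py \<alpha>x \<alpha>y (init_pt I - u) / T \<le> \<epsilon>"
        using T(1,3) \<open>\<epsilon> > 0\<close> by (simp add: field_simps)
      then show "ereal (saddle_obj I (fst (zbar T)) (snd u) - saddle_obj I (fst u) (snd (zbar T)))
          \<le> ereal \<epsilon>"
        using bound(2)[of u] u by simp
    qed
    ultimately show ?thesis
      unfolding comm_time_def using T(3) by (intro INF_lower) auto
  qed
  then have "comm_complexity Px Py Dx Dy \<epsilon> M \<C> \<le> enat (2 * T)"
    unfolding comm_complexity_def by (rule SUP_least)
  then have "ereal_of_enat (comm_complexity Px Py Dx Dy \<epsilon> M \<C>) \<le> ereal_of_enat (enat (2 * T))"
    by (simp only: ereal_of_enat_le_iff)
  also have "\<dots> \<le> ereal (2 + 4 * (Lxy * Dx * Dy / \<epsilon>))"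
    using T(2) by (simp add: c_def)
  finally show ?thesis .
qed

end
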